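(* Let $\psi$ be the real root of $x^3=x^2+x+1$. For all integers $n\ge0$, $$-0.596<[(n)_T\,0]_T-\psi n<0.856,$$ $$-0.883<[(n)_T\,00]_T-\psi^2 n<1.460,$$ $$-1.461<[(n)_T\,000]_T-\psi^3 n<2.298.$$
   Context: Tribonacci numbers: $T_{-3}=T_{-2}=0$, $T_{-1}=1$, $T_n=T_{n-1}+T_{n-2}+T_{n-3}$ for $n\ge0$ (so $T_0=1,T_1=2,T_2=4,T_3=7$). For a finite binary string $E=e_1\cdots e_i$, $[E]_T=\sum_{1\le j\le i}e_jT_{i-j}$. For an integer $n\ge0$, $(n)_T$ is the canonical Tribonacci representation of $n$: the binary string obtained by the greedy algorithm (repeatedly subtracting the largest possible Tribonacci number), least significant digit on the right, equivalently the string $E$ with $[E]_T=n$ having no three consecutive $1$'s (unique up to leading zeros). $(n)_T\,0$, etc., denotes concatenation of binary strings. *)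

theory Defs
  imports Complex_Main
begin

(* T_n for n >= -3, with T_{-3} = T_{-2} = 0 and T_{-1} = 1; indices below -3 lie outside the
   sequence and are sent to 0. *)
function trib :: "int \<Rightarrow> nat" where
  "trib n = (if n \<le> -2 then 0 else if n = -1 then 1
             else trib (n - 1) + trib (n - 2) + trib (n - 3))"
  by pat_completeness auto
termination by (relation "measure (\<lambda>n. nat (n + 3))") auto

declare trib.simps [simp del]

lemma trib_init:
  "trib (-3) = 0" "trib (-2) = 0" "trib (-1) = 1" "trib 0 = 1" "trib 1 = 2" "trib 2 = 4" "trib 3 = 7"
  by (simp_all add: trib.simps)

lemma trib_rec: "0 \<le> n \<Longrightarrow> trib n = trib (n - 1) + trib (n - 2) + trib (n - 3)"
  by (subst trib.simps) simp

(* Strings are digit lists, most significant digit first. In 1-based indexing the j-th digit of a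
   string of length i has weight T_{i-j}. *)
definition trib_val :: "nat list \<Rightarrow> nat" where
  "trib_val E = (\<Sum>j = 1..length E. E ! (j - 1) * trib (int (length E) - int j))"

(* The greedy digits of n at the places T_{k-1}, ..., T_0. A single top-down pass implements
   "repeatedly subtract the largest possible Tribonacci number": since T_{k+1} <= 2 T_k, no T_k is
   subtracted twice. *)
fun trib_greedy :: "nat \<Rightarrow> nat \<Rightarrow> nat list" where
  "trib_greedy 0 n = []"
| "trib_greedy (Suc k) n =
     (if trib (int k) \<le> n then 1 # trib_greedy k (n - trib (int k)) else 0 # trib_greedy k n)"

(* The number of digits is the least k with n < T_k, so there are no leading zeros and 0 is
   represented by the empty string. *)
definition trib_rep :: "nat \<Rightarrow> nat list" where
  "trib_rep n = trib_greedy (LEAST k. n < trib (int k)) n"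

lemma trib_pos: "n \<ge> -1 \<Longrightarrow> 0 < trib n"
proof (induction n rule: trib.induct)
  case (1 n)
  show ?case
  proof (cases "n = -1")
    case False
    with "1.prems" have "0 \<le> n" by simp
    moreover from this have "0 < trib (n - 1)" by (intro "1.IH"(1)) auto
    ultimately show ?thesis using trib_rec[of n] by linarith
  qed (simp add: trib_init)
qed

lemma trib_less_Suc: "trib (int k) < trib (int (Suc k))"
proof (cases k)
  case 0
  then show ?thesis by (simp add: trib_init)
next
  case (Suc m)
  have "trib (int (Suc k)) = trib (int k) + trib (int k - 1) + trib (int k - 2)"
    using trib_rec[of "int (Suc k)"] by (simp add: algebra_simps)
  moreover have "0 < trib (int k - 1)"
    using Suc by (intro trib_pos) auto
  ultimately show ?thesis by simp
qed

lemma trib_gt_arg: "k < trib (int k)"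
proof (induction k)
  case (Suc k)
  then show ?case using trib_less_Suc[of k] by linarith
qed (simp add: trib_init)

lemma trib_Suc_le_double: "trib (int (Suc k)) \<le> 2 * trib (int k)"
proof -
  have "trib (int (Suc k)) = trib (int k) + trib (int k - 1) + trib (int k - 2)"
    using trib_rec[of "int (Suc k)"] by (simp add: algebra_simps)
  moreover have "trib (int k) = trib (int k - 1) + trib (int k - 2) + trib (int k - 3)"
    by (rule trib_rec) simp
  ultimately show ?thesis by linarith
qed

lemma trib_val_Nil [simp]: "trib_val [] = 0"
  by (simp add: trib_val_def)

lemma trib_val_Cons: "trib_val (e # E) = e * trib (int (length E)) + trib_val E"
proof -
  have "trib_val (e # E) =
      e * trib (int (length E)) +
      (\<Sum>j = Suc 1..Suc (length E). (e # E) ! (j - 1) * trib (int (Suc (length E)) - int j))"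
    unfolding trib_val_def by (subst sum.atLeast_Suc_atMost) simp_all
  also have "(\<Sum>j = Suc 1..Suc (length E). (e # E) ! (j - 1) * trib (int (Suc (length E)) - int j))
      = trib_val E"
    unfolding trib_val_def sum.shift_bounds_cl_Suc_ivl by (intro sum.cong) (auto simp: nth_Cons')
  finally show ?thesis .
qed

lemma length_trib_greedy [simp]: "length (trib_greedy k n) = k"
  by (induction k arbitrary: n) auto

lemma trib_val_greedy: "n < trib (int k) \<Longrightarrow> trib_val (trib_greedy k n) = n"
proof (induction k arbitrary: n)
  case (Suc k)
  then show ?case
    using trib_Suc_le_double[of k] by (auto simp: trib_val_Cons)
qed (simp add: trib_init)

lemma trib_val_rep: "trib_val (trib_rep n) = n"
  unfolding trib_rep_def by (rule trib_val_greedy, rule LeastI, rule trib_gt_arg)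

lemma set_trib_rep: "set (trib_rep n) \<subseteq> {0, 1}"
proof -
  have "set (trib_greedy k m) \<subseteq> {0, 1}" for k m
    by (induction k arbitrary: m) auto
  then show ?thesis by (simp add: trib_rep_def)
qed

lemma trib_greedy_no_111:
  "n < trib (int k) \<Longrightarrow> trib_greedy k n \<noteq> xs @ [1, 1, 1] @ ys"
proof (induction k arbitrary: n xs)
  case (Suc k)
  show ?case
  proof (cases xs)
    case Nil
    show ?thesis
    proof
      assume eq: "trib_greedy (Suc k) n = xs @ [1, 1, 1] @ ys"
      have "length (trib_greedy (Suc k) n) = length (xs @ [1, 1, 1] @ ys)" by (rule arg_cong [OF eq])
      then have "k = Suc (Suc (length ys))" using Nil by (simp del: trib_greedy.simps)
      then obtain m where k: "k = Suc (Suc m)" ..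
      have "trib (int k) + trib (int (Suc m)) + trib (int m) \<le> n"
        using eq Nil k by (auto split: if_splits)
      moreover have "trib (int (Suc k)) = trib (int k) + trib (int (Suc m)) + trib (int m)"
        using trib_rec[of "int (Suc k)"] k by (simp add: algebra_simps)
      ultimately show False using Suc.prems by simp
    qed
  next
    case (Cons x xs')
    then show ?thesis
      using Suc.IH[of n xs'] Suc.IH[of "n - trib (int k)" xs'] Suc.prems
        trib_Suc_le_double[of k] by auto
  qed
qed simp

lemma trib_rep_no_111: "trib_rep n \<noteq> xs @ [1, 1, 1] @ ys"
  unfolding trib_rep_def by (rule trib_greedy_no_111, rule LeastI, rule trib_gt_arg)

end

theory Submission
  imports Defs
begin

text \<open>
  Appending \<open>p\<close> zeros to \<open>(n)\<^sub>T\<close> replaces every weight \<open>T\<^sub>k\<close> by \<open>T\<^sub>k\<^sub>+\<^sub>p\<close>, so the quantity to be bounded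
  is the sum of \<open>T\<^sub>k\<^sub>+\<^sub>p - \<psi>\<^sup>p T\<^sub>k\<close> over the places \<open>k\<close> of the digits 1 of \<open>(n)\<^sub>T\<close>. In these weights
  the term in \<open>\<psi>\<^sup>k\<close> cancels: they are combinations of the \<open>k\<close>-th powers of the two complex roots of
  \<open>x\<^sup>3 = x\<^sup>2 + x + 1\<close>, whose modulus \<open>1 / sqrt \<psi>\<close> is less than 0.74. A quadratic form that shrinks by
  the factor \<open>\<psi>\<close> at each place (\<open>deviation_form_step\<close>) turns this into the explicit geometric bound
  \<open>abs_deviation_le\<close>, so that all the digits from place 30 upwards together contribute less than
  0.0012.

  What remains is to maximize a linear function of the thirty lowest digits over strings without
  three consecutive 1's. This is done in integers, by dynamic programming from the high places
  downwards (\<open>max_sums\<close>, \<open>digit_sum_le_max_sums\<close>); the state is the number of 1's immediately below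
  the current place. The computed maxima, which include the allowance for the tail and a safe rounding
  of \<open>\<psi>\<close>, stay below the claimed bounds by at least 0.005.
\<close>

section \<open>Digit sums with arbitrary weights\<close>

text \<open>The sum of \<open>f\<close> weighted by a digit list that is read from the \<^emph>\<open>least\<close> significant digit on, the
  first digit standing at place \<open>k\<close>.\<close>

fun digit_sum :: "(nat \<Rightarrow> real) \<Rightarrow> nat \<Rightarrow> nat list \<Rightarrow> real" where
  "digit_sum f k [] = 0"
| "digit_sum f k (d # ds) = real d * f k + digit_sum f (Suc k) ds"

lemma digit_sum_snoc: "digit_sum f k (ds @ [d]) = digit_sum f k ds + real d * f (k + length ds)"
  by (induction ds arbitrary: k) auto

lemma digit_sum_diff:
  "digit_sum (\<lambda>k. f k - c * g k) k ds = digit_sum f k ds - c * digit_sum g k ds"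
  by (induction ds arbitrary: k) (auto simp: algebra_simps)

lemma digit_sum_scale: "digit_sum (\<lambda>k. c * f k) k ds = c * digit_sum f k ds"
  by (induction ds arbitrary: k) (auto simp: algebra_simps)

text \<open>\<open>trib_val\<close> reads its digits from the most significant one on, hence the reversal.\<close>

lemma trib_val_append_zeros:
  "real (trib_val (E @ replicate p 0)) = digit_sum (\<lambda>k. real (trib (int (k + p)))) 0 (rev E)"
proof (induction E)
  case Nil
  have "trib_val (replicate p 0) = 0"
    by (induction p) (auto simp: trib_val_Cons)
  then show ?case by simp
qed (simp add: trib_val_Cons digit_sum_snoc)

lemma trib_shift: "trib (int (k + 3)) = trib (int (k + 2)) + trib (int (k + 1)) + trib (int k)"
  using trib_rec[of "int (k + 3)"] by (simp add: algebra_simps)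

text \<open>Whether the digits \<open>ds\<close>, least significant first, are all 0 or 1 and produce no three consecutive
  1's when they are placed above \<open>s \<le> 2\<close> consecutive 1's.\<close>

fun admissible :: "nat \<Rightarrow> nat list \<Rightarrow> bool" where
  "admissible s [] = True"
| "admissible s (d # ds) = (d = 0 \<and> admissible 0 ds \<or> d = 1 \<and> s < 2 \<and> admissible (Suc s) ds)"

lemma admissibleI:
  assumes "set ds \<subseteq> {0, 1}" "\<And>xs ys. replicate s 1 @ ds \<noteq> xs @ [1, 1, 1] @ ys"
  shows "admissible s ds"
  using assms
proof (induction ds arbitrary: s)
  case (Cons d ds)
  consider "d = 0" | "d = 1" using Cons.prems(1) by auto
  then show ?case
  proof cases
    case 1
    have "ds \<noteq> xs @ [1, 1, 1] @ ys" for xs ys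
      using Cons.prems(2)[of "replicate s 1 @ [d] @ xs" ys] by auto
    then show ?thesis using 1 Cons.IH[of 0] Cons.prems(1) by simp
  next
    case 2
    have shift: "replicate (Suc s) 1 @ ds = replicate s 1 @ d # ds"
      using 2 by (simp add: replicate_app_Cons_same)
    have "s < 2"
    proof (rule ccontr)
      assume "\<not> s < 2"
      then have "s = (s - 2) + 2" by simp
      then have "replicate s (1::nat) = replicate (s - 2) 1 @ replicate 2 1"
        by (metis replicate_add)
      then show False using Cons.prems(2)[of "replicate (s - 2) 1" ds] 2
        by (simp add: numeral_2_eq_2)
    qed
    moreover have "admissible (Suc s) ds"
      by (rule Cons.IH) (use Cons.prems shift in auto)
    ultimately show ?thesis using 2 by simp
  qed
qed simp

lemma admissible_rev_trib_rep: "admissible 0 (rev (trib_rep n))"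
proof (rule admissibleI)
  fix xs ys
  show "replicate 0 1 @ rev (trib_rep n) \<noteq> xs @ [1, 1, 1] @ ys"
  proof
    assume "replicate 0 1 @ rev (trib_rep n) = xs @ [1, 1, 1] @ ys"
    then have "trib_rep n = rev ys @ [1, 1, 1] @ rev xs"
      by (simp add: rev_swap)
    then show False using trib_rep_no_111 by blast
  qed
qed (use set_trib_rep[of n] in simp)

lemma admissible_digit_sum_le_geometric:
  fixes C q :: real
  assumes bound: "\<And>k. \<bar>f k\<bar> \<le> C * q ^ k" and q: "0 \<le> q" "q < 1" and "admissible s ds"
  shows "digit_sum f k ds \<le> C * q ^ k / (1 - q)"
  using \<open>admissible s ds\<close>
proof (induction ds arbitrary: s k)
  case Nil
  have "0 \<le> C * q ^ k" using bound[of k] by linarith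
  then show ?case using q by simp
next
  case (Cons d ds)
  obtain s' where "admissible s' ds" using Cons.prems by auto
  then have "digit_sum f (Suc k) ds \<le> C * q ^ Suc k / (1 - q)" by (rule Cons.IH)
  moreover have "real d * f k \<le> C * q ^ k"
    using Cons.prems bound[of k] by auto
  moreover have "C * q ^ k + C * q ^ Suc k / (1 - q) = C * q ^ k / (1 - q)"
    using q by (simp add: field_simps)
  ultimately show ?case by simp
qed


section \<open>Maximal digit sums by dynamic programming\<close>

text \<open>Integer upper bounds for digit sums over \<open>n\<close> places followed by a tail whose sum is at most \<open>\<tau>\<close>; the three
  components belong to 0, 1 and 2 consecutive 1's below the first of these places. The arguments
  \<open>a\<close>, \<open>b\<close>, \<open>c\<close> are the Tribonacci numbers at that place and the two above it, and the weight of the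
  place is \<open>x a + y b + z c\<close>.\<close>

fun max_sums ::
  "int \<Rightarrow> int \<Rightarrow> int \<Rightarrow> int \<Rightarrow> nat \<Rightarrow> int \<Rightarrow> int \<Rightarrow> int \<Rightarrow> int \<times> int \<times> int" where
  "max_sums x y z \<tau> 0 a b c = (\<tau>, \<tau>, \<tau>)"
| "max_sums x y z \<tau> (Suc n) a b c =
     (case max_sums x y z \<tau> n b c (a + b + c) of (h0, h1, h2) \<Rightarrow>
       (let w = x * a + y * b + z * c in (max h0 (w + h1), max h0 (w + h2), h0)))"

lemma digit_sum_le_max_sums:
  fixes f :: "nat \<Rightarrow> real"
  assumes weight: "\<And>k. f k \<le> of_int (x * int (trib (int k)) + y * int (trib (int (k + 1)))
                                     + z * int (trib (int (k + 2))))"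
    and tail: "\<And>s ds. admissible s ds \<Longrightarrow> digit_sum f K ds \<le> of_int \<tau>"
    and "k + n = K"
    and "max_sums x y z \<tau> n (int (trib (int k))) (int (trib (int (k + 1))))
           (int (trib (int (k + 2)))) = (h0, h1, h2)"
  shows "(admissible 0 ds \<longrightarrow> digit_sum f k ds \<le> of_int h0) \<and>
         (admissible 1 ds \<longrightarrow> digit_sum f k ds \<le> of_int h1) \<and>
         (admissible 2 ds \<longrightarrow> digit_sum f k ds \<le> of_int h2)"
  using assms(3,4)
proof (induction n arbitrary: k ds h0 h1 h2)
  case 0
  then show ?case using tail by auto
next
  case (Suc n)
  define w where "w = x * int (trib (int k)) + y * int (trib (int (k + 1)))
                      + z * int (trib (int (k + 2)))"
  obtain g0 g1 g2 where
    g: "max_sums x y z \<tau> n (int (trib (int (Suc k)))) (int (trib (int (Suc k + 1))))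
          (int (trib (int (Suc k + 2)))) = (g0, g1, g2)"
    by (metis prod_cases3)
  have arg: "int (trib (int k)) + int (trib (int (k + 1))) + int (trib (int (k + 2)))
             = int (trib (int (Suc k + 2)))"
    using trib_shift[of k] by (simp add: algebra_simps)
  have idx: "Suc k = k + 1" "Suc k + 1 = k + 2" by simp_all
  have h: "h0 = max g0 (w + g1)" "h1 = max g0 (w + g2)" "h2 = g0"
    using Suc.prems(2) g[unfolded idx] arg[unfolded idx]
    unfolding max_sums.simps(2) Let_def w_def by (simp_all only: idx arg split: prod.splits) auto
  have fk: "f k \<le> of_int w"
    using weight[of k] unfolding w_def .
  show ?case
  proof (cases ds)
    case Nil
    \<comment> \<open>the induction hypothesis applies to the empty string, whose sum is 0\<close>
    have "0 \<le> g0"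
      using Suc.IH[OF _ g, of "[]"] Suc.prems(1) by simp
    then show ?thesis
      unfolding Nil h by (simp add: max.coboundedI1)
  next
    case (Cons d es)
    have IH: "admissible 0 es \<Longrightarrow> digit_sum f (Suc k) es \<le> of_int g0"
      "admissible 1 es \<Longrightarrow> digit_sum f (Suc k) es \<le> of_int g1"
      "admissible 2 es \<Longrightarrow> digit_sum f (Suc k) es \<le> of_int g2"
      using Suc.IH[OF _ g, of es] Suc.prems(1) by simp_all
    show ?thesis
      using IH fk unfolding Cons h by (auto simp: numeral_2_eq_2)
  qed
qed


section \<open>The deviation of the Tribonacci numbers from a geometric sequence\<close>

text \<open>Evaluating the cubic at \<open>c\<close> decides the side of \<open>c\<close> on which its only real root lies. The
  cofactor \<open>r\<close> of \<open>\<psi> - c\<close> is positive for \<open>c > 5 / 3\<close>.\<close>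

lemma tribonacci_root_less:
  fixes \<psi> c :: real
  assumes "\<psi> ^ 3 = \<psi> ^ 2 + \<psi> + 1" "1.8 \<le> c"
  shows "c ^ 2 + c + 1 < c ^ 3 \<Longrightarrow> \<psi> < c" and "c ^ 3 < c ^ 2 + c + 1 \<Longrightarrow> c < \<psi>"
proof -
  define r where "r = \<psi> ^ 2 + (c - 1) * \<psi> + (c ^ 2 - c - 1)"
  have "4 * r = (2 * \<psi> + (c - 1)) ^ 2 + (3 * c - 5) * (c + 1)"
    unfolding r_def by algebra
  moreover have "(3 * c - 5) * (c + 1) > 0"
    using assms(2) by (intro mult_pos_pos) auto
  ultimately have "r > 0"
    using zero_le_power2[of "2 * \<psi> + (c - 1)"] by linarith
  have factor: "(\<psi> - c) * r = - (c ^ 3 - c ^ 2 - c - 1)"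
    using assms(1) unfolding r_def by algebra
  show "c ^ 2 + c + 1 < c ^ 3 \<Longrightarrow> \<psi> < c"
    using factor \<open>r > 0\<close> by (smt (verit) mult_nonneg_nonneg)
  show "c ^ 3 < c ^ 2 + c + 1 \<Longrightarrow> c < \<psi>"
    using factor \<open>r > 0\<close> by (smt (verit) mult_nonpos_nonneg)
qed

context
  fixes \<psi> :: real
  assumes root: "\<psi> ^ 3 = \<psi> ^ 2 + \<psi> + 1"
begin

lemma root_bounds: "1.839286755214 < \<psi>" "\<psi> < 1.839286755215"
  by (rule tribonacci_root_less[OF root]; simp add: power2_eq_square power3_eq_cube)+

text \<open>The contribution of a digit 1 at place \<open>k\<close> when \<open>p\<close> zeros are appended.\<close>

definition deviation :: "nat \<Rightarrow> nat \<Rightarrow> real" where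
  "deviation p k = real (trib (int (k + p))) - \<psi> ^ p * real (trib (int k))"

text \<open>Dividing \<open>x\<^sup>3 - x\<^sup>2 - x - 1\<close> by \<open>x - \<psi>\<close> leaves \<open>x\<^sup>2 + (\<psi> - 1) x + 1 / \<psi>\<close>, which gives a recurrence of
  order two for the deviations.\<close>

lemma deviation_shift: "\<psi> * deviation 1 (k + 2) = - \<psi> * (\<psi> - 1) * deviation 1 (k + 1) - deviation 1 k"
proof -
  have "real (trib (int (k + 3))) =
      real (trib (int (k + 2))) + real (trib (int (k + 1))) + real (trib (int k))"
    using trib_shift[of k] by simp
  moreover have "deviation 1 (k + 2) = real (trib (int (k + 3))) - \<psi> * real (trib (int (k + 2)))"
    "deviation 1 (k + 1) = real (trib (int (k + 2))) - \<psi> * real (trib (int (k + 1)))"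
    "deviation 1 k = real (trib (int (k + 1))) - \<psi> * real (trib (int k))"
    by (simp_all add: deviation_def algebra_simps)
  ultimately show ?thesis using root by algebra
qed

text \<open>A positive definite quadratic form in two consecutive deviations. Up to the factor \<open>\<psi>\<close> it is the
  norm form \<open>(v - \<alpha> u) (v - \<beta> u)\<close> of the roots \<open>\<alpha>\<close>, \<open>\<beta>\<close> of \<open>x\<^sup>2 + (\<psi> - 1) x + 1 / \<psi>\<close>, and therefore
  scales by \<open>\<alpha> \<beta> = 1 / \<psi>\<close> from one place to the next.\<close>

definition deviation_form :: "nat \<Rightarrow> real" where
  "deviation_form k = \<psi> * deviation 1 (k + 1) ^ 2
     + \<psi> * (\<psi> - 1) * deviation 1 (k + 1) * deviation 1 k + deviation 1 k ^ 2"

lemma deviation_form_step: "\<psi> * deviation_form (Suc k) = deviation_form k"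
proof -
  define u v w where "u = deviation 1 k" and "v = deviation 1 (k + 1)" and "w = deviation 1 (k + 2)"
  have "deviation_form (Suc k) = \<psi> * w ^ 2 + \<psi> * (\<psi> - 1) * w * v + v ^ 2"
    "deviation_form k = \<psi> * v ^ 2 + \<psi> * (\<psi> - 1) * v * u + u ^ 2"
    by (simp_all add: deviation_form_def u_def v_def w_def)
  moreover have "\<psi> * w = - \<psi> * (\<psi> - 1) * v - u"
    unfolding u_def v_def w_def by (rule deviation_shift)
  ultimately show ?thesis by algebra
qed

lemma deviation_form_le: "deviation_form k \<le> 0.3 * (0.74 ^ k) ^ 2"
proof (induction k)
  case 0
  have d: "deviation 1 0 = 2 - \<psi>" "deviation 1 1 = 4 - 2 * \<psi>"
    by (simp_all add: deviation_def trib_init)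
  have "deviation_form 0 = \<psi> * (2 - \<psi>)"
    unfolding deviation_form_def using d root by (simp, algebra)
  also have "\<dots> \<le> 1.84 * (2 - 1.839)"
    using root_bounds by (intro mult_mono) auto
  finally show ?case by simp
next
  case (Suc k)
  have "1 \<le> \<psi> * 0.74 ^ 2"
    using root_bounds by (simp add: power2_eq_square)
  then have "1 * (0.3 * (0.74 ^ k) ^ 2) \<le> \<psi> * 0.74 ^ 2 * (0.3 * (0.74 ^ k) ^ 2)"
    by (rule mult_right_mono) simp
  then have "\<psi> * deviation_form (Suc k) \<le> \<psi> * (0.3 * (0.74 ^ Suc k) ^ 2)"
    using Suc deviation_form_step[of k] unfolding power_Suc power_mult_distrib
    by (simp only: mult_ac mult_1_left)
  then show ?case
    using root_bounds by (simp only: mult_le_cancel_left_pos)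
qed

lemma abs_deviation_1_le: "\<bar>deviation 1 k\<bar> \<le> 0.67 * 0.74 ^ k"
proof -
  define x y where "x = deviation 1 k" and "y = deviation 1 (k + 1)"
  have "\<psi> * (\<psi> - 1) ^ 2 \<le> 1.84 * 0.84 ^ 2"
    using root_bounds by (intro mult_mono power_mono) auto
  then have "0.67 \<le> 1 - \<psi> * (\<psi> - 1) ^ 2 / 4" by (simp add: power2_eq_square)
  then have "0.67 * x ^ 2 \<le> (1 - \<psi> * (\<psi> - 1) ^ 2 / 4) * x ^ 2"
    by (intro mult_right_mono) auto
  \<comment> \<open>completing the square in \<open>y\<close>\<close>
  also have "\<dots> \<le> (1 - \<psi> * (\<psi> - 1) ^ 2 / 4) * x ^ 2 + \<psi> * (y + (\<psi> - 1) / 2 * x) ^ 2"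
    using root_bounds by simp
  also have "\<dots> = deviation_form k"
    unfolding deviation_form_def x_def y_def by (simp add: power2_eq_square field_simps)
  also have "\<dots> \<le> 0.3 * (0.74 ^ k) ^ 2" by (rule deviation_form_le)
  also have "\<dots> \<le> 0.67 * (0.67 * 0.74 ^ k) ^ 2"
    unfolding power_mult_distrib[of "0.67"] by (simp add: power2_eq_square)
  finally have "x ^ 2 \<le> (0.67 * 0.74 ^ k) ^ 2" by simp
  then show ?thesis
    unfolding x_def by (rule abs_le_square_iff[THEN iffD2, THEN order_trans]) simp
qed

lemma deviation_2: "deviation 2 k = deviation 1 (k + 1) + \<psi> * deviation 1 k"
  by (simp add: deviation_def algebra_simps power2_eq_square numeral_2_eq_2)

lemma deviation_3: "deviation 3 k = deviation 1 k + deviation 2 k"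
  using trib_shift[of k] root by (simp add: deviation_def algebra_simps)

lemma abs_deviation_le:
  assumes "p \<in> {1, 2, 3}"
  shows "\<bar>deviation p k\<bar> \<le> 2.5 * 0.74 ^ k"
proof -
  have 1: "\<bar>deviation 1 k\<bar> \<le> 0.67 * 0.74 ^ k" "\<bar>deviation 1 (k + 1)\<bar> \<le> 0.67 * 0.74 * 0.74 ^ k"
    using abs_deviation_1_le[of k] abs_deviation_1_le[of "k + 1"] by simp_all
  have "\<bar>\<psi> * deviation 1 k\<bar> \<le> 1.84 * (0.67 * 0.74 ^ k)"
    unfolding abs_mult using root_bounds 1 by (intro mult_mono) auto
  then have 2: "\<bar>deviation 2 k\<bar> \<le> (0.67 * 0.74 + 1.84 * 0.67) * 0.74 ^ k"
    unfolding deviation_2 using 1(2)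
      abs_triangle_ineq[of "deviation 1 (k + 1)" "\<psi> * deviation 1 k"] by simp
  have 3: "\<bar>deviation 3 k\<bar> \<le> (0.67 + (0.67 * 0.74 + 1.84 * 0.67)) * 0.74 ^ k"
    unfolding deviation_3 using 1(1) 2
      abs_triangle_ineq[of "deviation 1 k" "deviation 2 k"] by simp
  have pos: "0 < (0.74 :: real) ^ k" by simp
  from assms consider "p = 1" | "p = 2" | "p = 3" by blast
  then show ?thesis
    using 1(1) 2 3 pos by cases simp_all
qed

lemma digit_sum_deviation:
  "digit_sum (deviation p) 0 (rev (trib_rep n)) =
     real (trib_val (trib_rep n @ replicate p 0)) - \<psi> ^ p * real n"
  using trib_val_append_zeros[of "trib_rep n" p] trib_val_append_zeros[of "trib_rep n" 0]
  unfolding deviation_def digit_sum_diff by (simp add: trib_val_rep)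

text \<open>Upper bounds come from \<open>c = 10\<^sup>1\<^sup>2\<close> and lower bounds from \<open>c = - 10\<^sup>1\<^sup>2\<close>. The scaling makes the weights
  integral once \<open>\<psi>\<^sup>p\<close> is replaced by a decimal with twelve places; the tail bound 0.0012 becomes
  1200000000.\<close>

lemma deviation_digit_sum_le:
  assumes p: "p \<in> {1, 2, 3}" and c: "\<bar>c\<bar> \<le> 1000000000000"
    and weight: "\<And>k. c * deviation p k \<le> of_int (x * int (trib (int k)) + y * int (trib (int (k + 1)))
                                                + z * int (trib (int (k + 2))))"
    and max_sums: "max_sums x y z 1200000000 30 1 2 4 = (h0, h1, h2)"
  shows "c * (real (trib_val (trib_rep n @ replicate p 0)) - \<psi> ^ p * real n) \<le> of_int h0"
proof -
  have abs: "\<bar>c * deviation p k\<bar> \<le> 2500000000000 * 0.74 ^ k" for k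
  proof -
    have "\<bar>c * deviation p k\<bar> \<le> 1000000000000 * (2.5 * 0.74 ^ k)"
      unfolding abs_mult using c abs_deviation_le[OF p, of k] by (intro mult_mono) auto
    then show ?thesis by simp
  qed
  have tail: "digit_sum (\<lambda>k. c * deviation p k) 30 ds \<le> of_int 1200000000"
    if "admissible s ds" for s ds
  proof -
    have "digit_sum (\<lambda>k. c * deviation p k) 30 ds \<le> 2500000000000 * 0.74 ^ 30 / (1 - 0.74)"
      by (rule admissible_digit_sum_le_geometric[OF abs _ _ that]) auto
    also have "\<dots> \<le> of_int 1200000000" by (simp add: field_simps)
    finally show ?thesis .
  qed
  have "digit_sum (\<lambda>k. c * deviation p k) 0 (rev (trib_rep n)) \<le> of_int h0"
    using digit_sum_le_max_sums[OF weight tail, where k = 0 and n = 30 and ds = "rev (trib_rep n)"] max_sums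
      admissible_rev_trib_rep[of n] by (simp add: trib_init)
  then show ?thesis by (simp only: digit_sum_scale digit_sum_deviation)
qed

end


section \<open>The six bounds\<close>

text \<open>The weights are \<open>\<plusminus> 10\<^sup>1\<^sup>2 (T\<^sub>k\<^sub>+\<^sub>p - \<psi>\<^sup>p T\<^sub>k)\<close> for \<open>p = 1, 2, 3\<close>, with \<open>\<psi>\<^sup>p\<close> rounded down for the upper
  sign and up for the lower one. For \<open>p = 3\<close>, \<open>T\<^sub>k\<^sub>+\<^sub>3 = T\<^sub>k\<^sub>+\<^sub>2 + T\<^sub>k\<^sub>+\<^sub>1 + T\<^sub>k\<close> puts \<open>1 - \<psi>\<^sup>3\<close> in front of \<open>T\<^sub>k\<close>.\<close>

lemma max_sums_values:
  "max_sums (-1839286755214) 1000000000000 0 1200000000 30 1 2 4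
     = (849430399506, 688717154720, 688717154720)"
  "max_sums 1839286755215 (-1000000000000) 0 1200000000 30 1 2 4
     = (590518098370, 590518098370, 590518098370)"
  "max_sums (-3382975767905) 0 1000000000000 1200000000 30 1 2 4
     = (1449357075915, 1215308611725, 832332843820)"
  "max_sums 3382975767910 0 (-1000000000000) 1200000000 30 1 2 4
     = (874980211420, 874980211420, 874980211420)"
  "max_sums (-5222262523119) 1000000000000 1000000000000 1200000000 30 1 2 4
     = (2279500522917, 1724025569155, 1501763046036)"
  "max_sums 5222262523125 (-1000000000000) (-1000000000000) 1200000000 30 1 2 4
     = (1446208121250, 1446208121250, 1446208121250)"
  by code_simp+

theorem theorem15:
  fixes \<psi> :: real and n :: nat
  assumes "\<psi> ^ 3 = \<psi> ^ 2 + \<psi> + 1"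
  shows "- 0.596 < real (trib_val (trib_rep n @ [0])) - \<psi> * real n
       \<and> real (trib_val (trib_rep n @ [0])) - \<psi> * real n < 0.856
       \<and> - 0.883 < real (trib_val (trib_rep n @ [0, 0])) - \<psi> ^ 2 * real n
       \<and> real (trib_val (trib_rep n @ [0, 0])) - \<psi> ^ 2 * real n < 1.460
       \<and> - 1.461 < real (trib_val (trib_rep n @ [0, 0, 0])) - \<psi> ^ 3 * real n
       \<and> real (trib_val (trib_rep n @ [0, 0, 0])) - \<psi> ^ 3 * real n < 2.298"
proof -
  note psi = root_bounds[OF assms]
  define t where "t k = real (trib (int k))" for k
  have "1.839286755214 ^ 2 \<le> \<psi> ^ 2" "\<psi> ^ 2 \<le> 1.839286755215 ^ 2"
    using psi by (intro power_mono; simp)+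
  then have psi2: "3.382975767905 \<le> \<psi> ^ 2" "\<psi> ^ 2 \<le> 3.382975767910"
    by (simp_all add: power2_eq_square)
  have psi3: "6.222262523119 \<le> \<psi> ^ 3" "\<psi> ^ 3 \<le> 6.222262523125"
    using assms psi psi2 by simp_all
  have lower: "a * t k \<le> \<psi> ^ p * t k" if "a \<le> \<psi> ^ p" for a p k
    unfolding t_def by (intro mult_right_mono that) simp
  have upper: "\<psi> ^ p * t k \<le> b * t k" if "\<psi> ^ p \<le> b" for b p k
    unfolding t_def by (intro mult_right_mono that) simp
  have dev: "deviation \<psi> 1 k = t (k + 1) - \<psi> ^ 1 * t k"
    "deviation \<psi> 2 k = t (k + 2) - \<psi> ^ 2 * t k"
    "deviation \<psi> 3 k = t (k + 2) + t (k + 1) + t k - \<psi> ^ 3 * t k" for k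
    using trib_shift[of k] by (simp_all add: deviation_def[OF assms] t_def)
  note bound = deviation_digit_sum_le[OF assms]
  have u1: "1000000000000 * (real (trib_val (trib_rep n @ replicate 1 0)) - \<psi> ^ 1 * real n) \<le> of_int 849430399506"
  proof (rule bound[OF _ _ _ max_sums_values(1)])
    fix k
    show "1000000000000 * deviation \<psi> 1 k \<le> of_int ((-1839286755214) * int (trib (int k))
        + 1000000000000 * int (trib (int (k + 1))) + 0 * int (trib (int (k + 2))))"
      using lower[of "1.839286755214" 1 k] psi unfolding dev by (simp add: t_def algebra_simps)
  qed simp_all
  have l1: "(- 1000000000000) * (real (trib_val (trib_rep n @ replicate 1 0)) - \<psi> ^ 1 * real n) \<le> of_int 590518098370"
  proof (rule bound[OF _ _ _ max_sums_values(2)])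
    fix k
    show "(- 1000000000000) * deviation \<psi> 1 k \<le> of_int (1839286755215 * int (trib (int k))
        + (-1000000000000) * int (trib (int (k + 1))) + 0 * int (trib (int (k + 2))))"
      using upper[of 1 "1.839286755215" k] psi unfolding dev by (simp add: t_def algebra_simps)
  qed simp_all
  have u2: "1000000000000 * (real (trib_val (trib_rep n @ replicate 2 0)) - \<psi> ^ 2 * real n) \<le> of_int 1449357075915"
  proof (rule bound[OF _ _ _ max_sums_values(3)])
    fix k
    show "1000000000000 * deviation \<psi> 2 k \<le> of_int ((-3382975767905) * int (trib (int k))
        + 0 * int (trib (int (k + 1))) + 1000000000000 * int (trib (int (k + 2))))"
      using lower[of "3.382975767905" 2 k] psi2 unfolding dev by (simp add: t_def algebra_simps)
  qed simp_all
  have l2: "(- 1000000000000) * (real (trib_val (trib_rep n @ replicate 2 0)) - \<psi> ^ 2 * real n) \<le> of_int 874980211420"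
  proof (rule bound[OF _ _ _ max_sums_values(4)])
    fix k
    show "(- 1000000000000) * deviation \<psi> 2 k \<le> of_int (3382975767910 * int (trib (int k))
        + 0 * int (trib (int (k + 1))) + (-1000000000000) * int (trib (int (k + 2))))"
      using upper[of 2 "3.382975767910" k] psi2 unfolding dev by (simp add: t_def algebra_simps)
  qed simp_all
  have u3: "1000000000000 * (real (trib_val (trib_rep n @ replicate 3 0)) - \<psi> ^ 3 * real n) \<le> of_int 2279500522917"
  proof (rule bound[OF _ _ _ max_sums_values(5)])
    fix k
    show "1000000000000 * deviation \<psi> 3 k \<le> of_int ((-5222262523119) * int (trib (int k))
        + 1000000000000 * int (trib (int (k + 1))) + 1000000000000 * int (trib (int (k + 2))))"
      using lower[of "6.222262523119" 3 k] psi3 unfolding dev by (simp add: t_def algebra_simps)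
  qed simp_all
  have l3: "(- 1000000000000) * (real (trib_val (trib_rep n @ replicate 3 0)) - \<psi> ^ 3 * real n) \<le> of_int 1446208121250"
  proof (rule bound[OF _ _ _ max_sums_values(6)])
    fix k
    show "(- 1000000000000) * deviation \<psi> 3 k \<le> of_int (5222262523125 * int (trib (int k))
        + (-1000000000000) * int (trib (int (k + 1))) + (-1000000000000) * int (trib (int (k + 2))))"
      using upper[of 3 "6.222262523125" k] psi3 unfolding dev by (simp add: t_def algebra_simps)
  qed simp_all
  have zeros: "replicate 1 0 = [0::nat]" "replicate 2 0 = [0::nat, 0]"
    "replicate 3 0 = [0::nat, 0, 0]"
    by (simp_all add: numeral_2_eq_2 numeral_3_eq_3)
  show ?thesis
    using u1 l1 u2 l2 u3 l3 unfolding zeros power_one_right by simp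
qed

end
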